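(* For an odd prime $p$ and an integer $t$ put $F_p(z)=1+\sum_{k=1}^{p-1}\left(\frac{k}{p}\right)z^k$ (modified Fekete polynomial) and $F_p^t(z)=\sum_{k=0}^{p-1}\left(\frac{k+t}{p}\right)z^k$ (shifted Fekete polynomial), where $\left(\frac{\cdot}{p}\right)$ is the Legendre symbol. Then for every real number $\alpha\ge0$ the sequence $\left(F_p/\|F_p\|_2\right)_p$ is not $L^\alpha$-flat, and for every integer $t$ the sequence $\left(F_p^t/\|F_p^t\|_2\right)_p$ is not $L^\alpha$-flat, where both sequences are indexed by the odd primes $p$.
   Context: $S^1$ is the unit circle in $\mathbb{C}$ with normalized Lebesgue measure $dz$. The Legendre symbol $\left(\frac{k}{p}\right)$ is $0$ if $p\mid k$, $1$ if $k$ is a nonzero square modulo $p$, and $-1$ otherwise. For $\alpha>0$, $\|f\|_\alpha = \left(\int_{S^1}|f|^\alpha\,dz\right)^{1/\alpha}$, and $\|f\|_0=M(f)=\exp\left(\int_{S^1}\log|f|\,dz\right)$ is the Mahler measure. A sequence $(p_n)$ of analytic trigonometric polynomials (polynomials in $z$ restricted to $S^1$) with $\|p_n\|_2=1$ is called $L^\alpha$-flat, for $\alpha>0$, if $\big\||p_n|-1\big\|_\alpha\to 0$ as $n\to\infty$; it is called $L^0$-flat if $M(p_n)\to 1$. For a sequence indexed by primes, the limit is taken as $p\to\infty$ along the primes. *)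

theory Defs
  imports
    "HOL-Analysis.Analysis"
    "HOL-Computational_Algebra.Polynomial"
    "HOL-Number_Theory.Residues"
begin

text \<open>Normalized Lebesgue measure on the unit circle, as a Borel measure on \<open>\<complex>\<close>
  (total mass \<open>1\<close>, concentrated on \<open>sphere 0 1\<close>).\<close>

definition circle_measure :: "complex measure" where
  "circle_measure = distr (restrict_space lborel {0..1::real}) borel (\<lambda>\<theta>. cis (2 * pi * \<theta>))"

text \<open>For \<open>\<alpha> = 0\<close> this is the Mahler measure. As \<open>ln 0 = 0\<close> in HOL, it has its usual meaning
  when \<open>f\<close> vanishes only on a null set of the circle and \<open>ln \<bar>f\<bar>\<close> is integrable; both hold for
  every nonzero polynomial.\<close>

definition circle_norm :: "real \<Rightarrow> (complex \<Rightarrow> 'a::real_normed_vector) \<Rightarrow> real" where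
  "circle_norm \<alpha> f =
     (if \<alpha> = 0 then exp (\<integral>z. ln (norm (f z)) \<partial>circle_measure)
      else (\<integral>z. norm (f z) powr \<alpha> \<partial>circle_measure) powr (1 / \<alpha>))"

text \<open>Flatness for \<open>\<alpha> \<ge> 0\<close> along a filter on the index set. The notion is only meant for
  families with \<open>circle_norm 2 (poly (P n)) = 1\<close>; this is not made part of the predicate, so that
  its negation cannot hold merely because the normalization fails.\<close>

definition flat_along :: "real \<Rightarrow> 'i filter \<Rightarrow> ('i \<Rightarrow> complex poly) \<Rightarrow> bool" where
  "flat_along \<alpha> F P \<longleftrightarrow>
     (if \<alpha> = 0 then ((\<lambda>n. circle_norm 0 (poly (P n))) \<longlongrightarrow> 1) F
      else ((\<lambda>n. circle_norm \<alpha> (\<lambda>z. cmod (poly (P n) z) - 1)) \<longlongrightarrow> 0) F)"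

definition L2_normalized :: "complex poly \<Rightarrow> complex poly" where
  "L2_normalized P = Polynomial.smult (complex_of_real (1 / circle_norm 2 (poly P))) P"

definition odd_primes_at_top :: "nat filter" where
  "odd_primes_at_top = inf at_top (principal {p. prime p \<and> odd p})"

definition modified_fekete :: "nat \<Rightarrow> complex poly" where
  "modified_fekete p = 1 + (\<Sum>k = 1..p - 1. Polynomial.monom (of_int (Legendre (int k) (int p))) k)"

definition shifted_fekete :: "int \<Rightarrow> nat \<Rightarrow> complex poly" where
  "shifted_fekete t p = (\<Sum>k = 0..p - 1. Polynomial.monom (of_int (Legendre (int k + t) (int p))) k)"

end

theory Submission
  imports Defs "HOL-Number_Theory.Euler_Criterion"
begin

text \<open>
  Flatness of any order \<open>\<alpha> \<ge> 0\<close> fails because Fekete polynomials have zeros on at least about half of the arcs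
  between neighbouring \<open>p\<close>-th roots of unity, and are therefore small, compared with their \<open>L\<^sup>2\<close> norm
  \<open>sqrt (p - 1)\<close>, on a part of the circle whose measure is bounded below.

  The zeros come from a symmetry argument. After multiplication by \<open>cis (- \<pi> p x)\<close> the Fekete
  polynomial at \<open>cis (2 \<pi> x)\<close> becomes a real function of \<open>x\<close> up to a constant factor \<open>1\<close> or \<open>\<i>\<close>. If
  \<open>j + 1 = j x\<^sup>2\<close> modulo \<open>p\<close>, the Fekete polynomial takes the same value at the \<open>j\<close>-th and \<open>(j + 1)\<close>-th
  roots of unity, while \<open>cis (- \<pi> p x)\<close> changes sign; so the real function has a zero in between
  (\<open>hartley_fekete_sign_change\<close>). There are at least \<open>(p - 3) / 2\<close> such \<open>j\<close> (\<open>many_square_steps\<close>).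

  By Parseval the derivative with respect to the parameter \<open>x \<in> [0, 1]\<close> has mean square of order
  \<open>p\<^sup>3\<close>. Hence on a positive proportion of the arcs, which have length \<open>1 / p\<close>, the function stays
  below \<open>sqrt p / 8\<close> on an interval around the zero of length comparable to \<open>1 / p\<close>; in total these
  intervals have measure at least \<open>1 / 2 ^ 17\<close> (\<open>fekete_small_on_large_set\<close>).

  A family that is normalized in \<open>L\<^sup>2\<close> and has modulus at most \<open>1 / 2\<close> on sets of measure bounded below is
  not flat for any \<open>\<alpha>\<close> (\<open>not_flat_along_if_often_small\<close>); for \<open>\<alpha> = 0\<close> this is the strict form of the
  inequality between the Mahler measure and the \<open>L\<^sup>2\<close> norm, and it needs the integrability of the
  logarithm of a polynomial on the circle. The modified polynomial differs from the Fekete polynomial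
  by \<open>1\<close>, and the modulus of the polynomial shifted by \<open>t\<close> differs from that of the Fekete polynomial
  by at most \<open>2 \<bar>t\<bar>\<close>, which is negligible against \<open>sqrt p\<close>.
\<close>

section \<open>The Legendre symbol\<close>

lemma Legendre_cases: "Legendre a p = 0 \<or> Legendre a p = 1 \<or> Legendre a p = - 1"
  by (auto simp: Legendre_def)

lemma Legendre_cong:
  assumes "[a = b] (mod p)"
  shows "Legendre a p = Legendre b p"
proof -
  have "[a = 0] (mod p) \<longleftrightarrow> [b = 0] (mod p)"
    using assms cong_trans cong_sym by blast
  moreover have "QuadRes p a \<longleftrightarrow> QuadRes p b"
    unfolding QuadRes_def using assms cong_trans cong_sym by blast
  ultimately show ?thesis by (simp add: Legendre_def)
qed

text \<open>Euler's criterion makes the two sides congruent modulo \<open>p\<close>; both lie in \<open>{-1, 0, 1}\<close>,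
  and these residues are distinct because \<open>p > 2\<close>.\<close>

lemma Legendre_mult:
  fixes p :: nat
  assumes p: "prime p" "2 < p"
  shows "Legendre (a * b) p = Legendre a p * Legendre b p"
proof -
  have "[Legendre (a * b) p = (a * b) ^ ((p - 1) div 2)] (mod p)"
    by (rule euler_criterion[OF p])
  moreover have "[Legendre a p * Legendre b p = (a * b) ^ ((p - 1) div 2)] (mod p)"
    unfolding power_mult_distrib by (intro cong_mult euler_criterion p)
  ultimately have "[Legendre (a * b) p = Legendre a p * Legendre b p] (mod p)"
    using cong_trans cong_sym by blast
  hence dvd: "int p dvd Legendre (a * b) p - Legendre a p * Legendre b p"
    by (simp add: cong_iff_dvd_diff)
  have "\<bar>Legendre (a * b) p - Legendre a p * Legendre b p\<bar> < int p"
    using p(2) Legendre_cases[of "a * b" p] Legendre_cases[of a p] Legendre_cases[of b p] by auto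
  thus ?thesis using dvd zdvd_not_zless[of "\<bar>Legendre (a * b) p - Legendre a p * Legendre b p\<bar>" p]
    by force
qed

lemma Legendre_mult_square:
  fixes p :: nat
  assumes p: "prime p" "2 < p" and x: "\<not> int p dvd x"
  shows "Legendre (a * x\<^sup>2) p = Legendre a p"
proof -
  have "Legendre x p \<noteq> 0" using x by (auto simp: Legendre_def cong_0_iff)
  hence "Legendre x p * Legendre x p = 1" using Legendre_cases[of x p] by auto
  thus ?thesis using p by (simp add: Legendre_mult power2_eq_square)
qed

lemma sum_residues_mult:
  fixes p :: nat and h :: "nat \<Rightarrow> 'a::comm_monoid_add"
  assumes p: "prime p" and m: "\<not> p dvd m"
  shows "(\<Sum>k = 1..p - 1. h ((k * m) mod p)) = (\<Sum>k = 1..p - 1. h k)"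
proof -
  let ?f = "\<lambda>k. (k * m) mod p"
  have p1: "p > 1" using p prime_gt_1_nat by blast
  have cop: "coprime m p" using p m by (metis coprime_commute prime_imp_coprime)
  have inj: "inj_on ?f {1..p - 1}"
  proof (rule inj_onI)
    fix x y assume xy: "x \<in> {1..p-1}" "y \<in> {1..p-1}" and eq: "?f x = ?f y"
    have "[x * m = y * m] (mod p)" using eq by (simp add: cong_def)
    hence "[x = y] (mod p)" using cop by (simp add: cong_mult_rcancel_nat)
    thus "x = y" using xy p1 by (auto simp: cong_def)
  qed
  have sub: "?f ` {1..p-1} \<subseteq> {1..p-1}"
  proof safe
    fix k assume k: "k \<in> {1..p-1}"
    have "\<not> p dvd k * m"
      using k m p by (auto simp: prime_dvd_mult_iff dest: dvd_imp_le)
    hence "?f k \<noteq> 0" by (simp add: dvd_eq_mod_eq_0)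
    moreover have "?f k < p" using p1 by simp
    ultimately show "?f k \<in> {1..p-1}" by simp
  qed
  have im: "?f ` {1..p-1} = {1..p-1}"
    using endo_inj_surj[OF _ sub inj] by simp
  show ?thesis
    using sum.reindex[OF inj, of h] im by (simp add: o_def)
qed

section \<open>Neighbouring roots of unity\<close>

lemma cis_2pi_int: "cis (2 * pi * of_int n) = 1"
  by (metis cis_multiple_2pi Ints_of_int)

text \<open>The substitution \<open>k \<mapsto> k x\<^sup>2\<close> permutes the nonzero residues and preserves the Legendre symbol, so the
  Fekete polynomial takes the same value at the \<open>p\<close>-th roots of unity with indices \<open>j\<close> and
  \<open>j x\<^sup>2\<close>. The case where these two indices are neighbours produces the sign changes below; no
  evaluation of the Gauss sum enters.\<close>

lemma fekete_at_roots_of_unity: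
  fixes p j x :: nat
  assumes p: "prime p" "2 < p" and x: "\<not> p dvd x"
    and step: "[Suc j = j * x\<^sup>2] (mod p)"
  shows "(\<Sum>k = 1..p - 1. of_int (Legendre (int k) (int p)) * cis (2 * pi * (real k * real (Suc j) / real p)))
       = (\<Sum>k = 1..p - 1. of_int (Legendre (int k) (int p)) * cis (2 * pi * (real k * real j / real p)))"
proof -
  define h where "h = (\<lambda>k. of_int (Legendre (int k) (int p)) * cis (2 * pi * (real k * real j / real p)) :: complex)"
  have p0: "real p > 0" using p by simp
  have x2: "\<not> p dvd x\<^sup>2" using p x by (simp add: prime_dvd_power_iff)
  have "of_int (Legendre (int k) (int p)) * cis (2 * pi * (real k * real (Suc j) / real p))
      = h ((k * x\<^sup>2) mod p)" for k
  proof -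
    have "Legendre (int ((k * x\<^sup>2) mod p)) p = Legendre (int k * (int x)\<^sup>2) p"
      by (rule Legendre_cong) (simp add: cong_def zmod_int)
    also have "\<dots> = Legendre (int k) p"
      by (rule Legendre_mult_square) (use p x in auto)
    finally have L: "Legendre (int ((k * x\<^sup>2) mod p)) p = Legendre (int k) p" .
    have "[k * Suc j = ((k * x\<^sup>2) mod p) * j] (mod p)"
    proof -
      have "[k * Suc j = k * (j * x\<^sup>2)] (mod p)" using step by (rule cong_scalar_left)
      also have "k * (j * x\<^sup>2) = (k * x\<^sup>2) * j" by (simp add: ac_simps)
      also have "[(k * x\<^sup>2) * j = ((k * x\<^sup>2) mod p) * j] (mod p)"
        by (intro cong_mult) (simp_all add: cong_def)
      finally show ?thesis .
    qed
    hence "[int (k * Suc j) = int (((k * x\<^sup>2) mod p) * j)] (mod int p)"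
      by (simp only: cong_int_iff)
    then obtain n where n: "int (k * Suc j) = int (((k * x\<^sup>2) mod p) * j) + int p * n"
      by (metis cong_iff_lin cong_sym)
    have "real_of_int (int (k * Suc j)) = real_of_int (int (((k * x\<^sup>2) mod p) * j) + int p * n)"
      by (simp only: n)
    hence "real k * real (Suc j) = real ((k * x\<^sup>2) mod p) * real j + real p * of_int n"
      by (simp only: of_int_add of_int_mult of_int_of_nat_eq of_nat_mult)
    hence "real k * real (Suc j) / real p = real ((k * x\<^sup>2) mod p) * real j / real p + of_int n"
      using p0 by (simp add: add_divide_distrib del: of_nat_Suc)
    hence "cis (2 * pi * (real k * real (Suc j) / real p))
         = cis (2 * pi * (real ((k * x\<^sup>2) mod p) * real j / real p))"
      by (simp only: distrib_left cis_2pi_int mult_1_right flip: cis_mult)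
    thus ?thesis using L by (simp add: h_def)
  qed
  hence "(\<Sum>k = 1..p - 1. of_int (Legendre (int k) (int p)) * cis (2 * pi * (real k * real (Suc j) / real p)))
      = (\<Sum>k = 1..p - 1. h ((k * x\<^sup>2) mod p))" by simp
  also have "\<dots> = (\<Sum>k = 1..p - 1. h k)" by (rule sum_residues_mult) (use p x2 in auto)
  finally show ?thesis by (simp add: h_def)
qed

text \<open>The congruence \<open>j + 1 = j x\<^sup>2\<close> is solved by \<open>j = 1 / (x\<^sup>2 - 1)\<close>. The index \<open>j\<close> determines
  \<open>x\<^sup>2\<close>, hence determines \<open>x\<close> among \<open>2, \<dots>, (p - 1) / 2\<close>, so distinct such \<open>x\<close> give distinct \<open>j\<close>:
  about half of all indices occur. This replaces the evaluation of the correlation sum of the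
  Legendre symbol at \<open>j\<close> and \<open>j + 1\<close>.\<close>

lemma many_square_steps:
  fixes p :: nat
  assumes p: "prime p" "2 < p"
  shows "(p - 3) div 2 \<le> card {j \<in> {..<p}. \<exists>x. \<not> p dvd x \<and> [Suc j = j * x\<^sup>2] (mod p)}"
    (is "_ \<le> card ?J")
proof -
  have odd: "odd p" using p prime_odd_nat by blast
  have ex: "\<exists>j. j \<in> ?J \<and> [int j * (int x ^ 2 - 1) = 1] (mod p)" if x: "x \<in> {2..(p - 1) div 2}" for x
  proof -
    have "int x ^ 2 - 1 = (int x - 1) * (int x + 1)" by (simp add: power2_eq_square algebra_simps)
    moreover have "\<not> int p dvd int x - 1" "\<not> int p dvd int x + 1"
      using x zdvd_imp_le[of "int p" "int x - 1"] zdvd_imp_le[of "int p" "int x + 1"] by auto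
    ultimately have "\<not> int p dvd int x ^ 2 - 1"
      using p prime_dvd_mult_iff[of "int p"] by auto
    hence "coprime (int x ^ 2 - 1) (int p)"
      using p by (metis coprime_commute prime_imp_coprime prime_int_nat_transfer nat_int of_nat_0_le_iff prime_nat_int_transfer)
    then obtain y where y: "[(int x ^ 2 - 1) * y = 1] (mod int p)"
      using cong_solve_coprime_int by blast
    define j where "j = nat (y mod int p)"
    have j: "int j = y mod int p" "j < p" using p by (auto simp: j_def nat_less_iff)
    have inv: "[int j * (int x ^ 2 - 1) = 1] (mod p)"
      unfolding j(1) using y by (simp add: cong_def mod_mult_left_eq mult.commute)
    have "[int (Suc j) = int (j * x\<^sup>2)] (mod p)"
      using inv by (auto simp: cong_iff_dvd_diff algebra_simps dvd_diff_commute)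
    hence "[Suc j = j * x\<^sup>2] (mod p)" by (simp only: cong_int_iff)
    moreover have "\<not> p dvd x" using x by (auto dest: dvd_imp_le)
    ultimately show ?thesis using j inv by auto
  qed
  hence "\<forall>x\<in>{2..(p - 1) div 2}. \<exists>j. j \<in> ?J \<and> [int j * (int x ^ 2 - 1) = 1] (mod p)" by blast
  from bchoice[OF this] obtain f
    where f0: "\<forall>x\<in>{2..(p - 1) div 2}. f x \<in> ?J \<and> [int (f x) * (int x ^ 2 - 1) = 1] (mod p)"
    by blast
  have f: "f x \<in> ?J" "[int (f x) * (int x ^ 2 - 1) = 1] (mod p)" if "x \<in> {2..(p - 1) div 2}" for x
    using f0 that by blast+
  have "inj_on f {2..(p - 1) div 2}"
  proof (rule inj_onI)
    fix x y assume x: "x \<in> {2..(p - 1) div 2}" and y: "y \<in> {2..(p - 1) div 2}" and eq: "f x = f y"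
    have "[int (f x) * (int x ^ 2 - 1) = int (f x) * (int y ^ 2 - 1)] (mod p)"
      using cong_trans[OF f(2)[OF x] cong_sym[OF f(2)[OF y]]] eq by simp
    moreover have "coprime (int (f x)) (int p)"
      using f(2)[OF x] unfolding coprime_iff_invertible_int by blast
    ultimately have "[int x ^ 2 - 1 = int y ^ 2 - 1] (mod p)" by (simp add: cong_mult_lcancel)
    hence "int p dvd (int x - int y) * (int x + int y)"
      by (simp add: cong_iff_dvd_diff power2_eq_square algebra_simps)
    hence "int p dvd int x - int y \<or> int p dvd int x + int y"
      using p prime_dvd_mult_iff[of "int p"] by auto
    moreover have "\<not> int p dvd int x + int y"
      using x y zdvd_imp_le[of "int p" "int x + int y"] by auto
    moreover have "\<bar>int x - int y\<bar> < int p" using x y by auto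
    ultimately show "x = y" using zdvd_not_zless[of "\<bar>int x - int y\<bar>" "int p"] by auto
  qed
  hence "card {2..(p - 1) div 2} \<le> card ?J"
    using f(1) by (intro card_inj_on_le) auto
  thus ?thesis using p odd by (auto elim!: oddE)
qed

section \<open>Parseval's identity\<close>

lemma has_integral_cis_int:
  "((\<lambda>x. cis (2 * pi * of_int m * x)) has_integral (if m = 0 then 1 else 0)) {0..1}"
proof (cases "m = 0")
  case True
  thus ?thesis using has_integral_const_real[of "1::complex" 0 1] by simp
next
  case False
  define w where "w = 2 * pi * real_of_int m"
  have w: "w \<noteq> 0" using False by (simp add: w_def)
  have "((\<lambda>x. cis (w * x)) has_integral (cis (w * 1) / (\<i> * w) - cis (w * 0) / (\<i> * w))) {0..1}"
  proof (rule fundamental_theorem_of_calculus)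
    fix x :: real
    have "((\<lambda>z. exp (\<i> * w * z) / (\<i> * w)) has_field_derivative exp (\<i> * w * of_real x))
            (at (of_real x))"
      using w by (auto intro!: derivative_eq_intros)
    from has_vector_derivative_real_field[OF this]
    show "((\<lambda>x. cis (w * x) / (\<i> * w)) has_vector_derivative cis (w * x)) (at x within {0..1})"
      by (simp add: cis_conv_exp o_def mult_ac)
  qed simp
  moreover have "cis w = 1" unfolding w_def by (rule cis_2pi_int)
  ultimately show ?thesis using False by (simp add: w_def)
qed

text \<open>The common frequency shift \<open>s\<close> leaves the modulus unchanged; it is carried along because the
  centred Fekete sum has the half-integral frequencies \<open>k - p / 2\<close>.\<close>

lemma parseval_cis:
  fixes a :: "nat \<Rightarrow> complex"
  assumes "finite K"
  shows "((\<lambda>x. (cmod (\<Sum>k\<in>K. a k * cis (2 * pi * (real k - s) * x)))\<^sup>2) has_integral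
            (\<Sum>k\<in>K. (cmod (a k))\<^sup>2)) {0..1}"
proof -
  let ?S = "\<lambda>x. \<Sum>k\<in>K. a k * cis (2 * pi * (real k - s) * x)"
  let ?e = "\<lambda>k l x. (a k * cnj (a l)) * cis (2 * pi * of_int (int k - int l) * x)"
  have "complex_of_real ((cmod (?S x))\<^sup>2) = (\<Sum>k\<in>K. \<Sum>l\<in>K. ?e k l x)" for x
  proof -
    have "complex_of_real ((cmod (?S x))\<^sup>2) = ?S x * cnj (?S x)"
      by (rule complex_norm_square)
    also have "\<dots> = (\<Sum>k\<in>K. \<Sum>l\<in>K. (a k * cis (2 * pi * (real k - s) * x)) *
                        cnj (a l * cis (2 * pi * (real l - s) * x)))"
      by (simp add: sum_product cnj_sum)
    also have "\<dots> = (\<Sum>k\<in>K. \<Sum>l\<in>K. ?e k l x)"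
      by (intro sum.cong refl) (simp add: cis_cnj cis_mult algebra_simps)
    finally show ?thesis .
  qed
  moreover have "((\<lambda>x. \<Sum>k\<in>K. \<Sum>l\<in>K. ?e k l x) has_integral
      (\<Sum>k\<in>K. \<Sum>l\<in>K. (a k * cnj (a l)) * (if int k - int l = 0 then 1 else 0))) {0..1}"
    by (intro has_integral_sum has_integral_mult_right has_integral_cis_int assms)
  moreover have "(\<Sum>k\<in>K. \<Sum>l\<in>K. (a k * cnj (a l)) * (if int k - int l = 0 then 1 else 0))
      = complex_of_real (\<Sum>k\<in>K. (cmod (a k))\<^sup>2)"
    using assms by (simp add: if_distrib [of "\<lambda>u. _ * u"] complex_norm_square sum.delta' del: of_real_power cong: if_cong)
  ultimately have "((\<lambda>x. complex_of_real ((cmod (?S x))\<^sup>2)) has_integral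
      complex_of_real (\<Sum>k\<in>K. (cmod (a k))\<^sup>2)) {0..1}" by simp
  from has_integral_Re[OF this] show ?thesis by simp
qed

section \<open>Smallness near a sign change\<close>

text \<open>A zero exists between \<open>a\<close> and \<open>b\<close>, and near it \<open>g\<close> can grow only as fast as the integral of
  \<open>\<bar>g'\<bar>\<close> allows. The inequality \<open>\<bar>g'\<bar> \<le> K / 2 + g'\<^sup>2 / (2 K)\<close>, with \<open>K\<close> free, bounds this integral
  by the integral of \<open>g'\<^sup>2\<close>, the only information that Parseval provides.\<close>

lemma small_near_sign_change:
  fixes g g' :: "real \<Rightarrow> real"
  assumes deriv: "\<And>x. (g has_real_derivative g' x) (at x)"
    and cont: "continuous_on UNIV g'"
    and sign: "g b = - g a"
    and l: "0 < l" "2 * l \<le> b - a" and K: "K > 0"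
    and bound: "K * l / 2 + integral {a..b} (\<lambda>x. (g' x)\<^sup>2) / (2 * K) \<le> \<eta>"
  shows "\<exists>c. a \<le> c \<and> c + l \<le> b \<and> (\<forall>x\<in>{c..c + l}. \<bar>g x\<bar> \<le> \<eta>)"
proof -
  have ab: "a \<le> b" using l by simp
  have gcont: "continuous_on {a..b} g"
    by (intro continuous_at_imp_continuous_on ballI DERIV_isCont[OF deriv])
  have "\<exists>z\<ge>a. z \<le> b \<and> g z = 0"
  proof (cases "g a \<le> 0")
    case True thus ?thesis using IVT'[of g a 0 b] gcont ab sign by auto
  next
    case False thus ?thesis using IVT2'[of g b 0 a] gcont ab sign by auto
  qed
  then obtain z where z: "a \<le> z" "z \<le> b" "g z = 0" by blast
  have c': "continuous_on S (\<lambda>x. (g' x)\<^sup>2)" for S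
    using continuous_on_subset[OF cont, of S] by (intro continuous_intros) auto
  have int': "(\<lambda>x. (g' x)\<^sup>2) integrable_on {u..v}" for u v
    by (intro integrable_continuous_interval c')
  have main: "\<bar>g v - g u\<bar> \<le> \<eta>" if uv: "a \<le> u" "u \<le> v" "v \<le> b" "v - u \<le> l" for u v
  proof -
    have "(g' has_integral (g v - g u)) {u..v}"
      using uv(2) deriv
      by (intro fundamental_theorem_of_calculus)
         (auto simp: has_real_derivative_iff_has_vector_derivative[symmetric] intro: has_field_derivative_at_within)
    hence eq: "g v - g u = integral {u..v} g'" "g' integrable_on {u..v}"
      by (auto simp: integral_unique has_integral_integrable)
    have "norm (integral {u..v} g') \<le> integral {u..v} (\<lambda>x. K / 2 + (g' x)\<^sup>2 / (2 * K))"
    proof (rule integral_norm_bound_integral[OF eq(2)])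
      show "(\<lambda>x. K / 2 + (g' x)\<^sup>2 / (2 * K)) integrable_on {u..v}"
        by (intro integrable_add integrable_const_ivl integrable_on_divide int')
      fix x
      have "0 \<le> (\<bar>g' x\<bar> - K)\<^sup>2 / (2 * K)" using K by simp
      also have "\<dots> = K / 2 + (g' x)\<^sup>2 / (2 * K) - \<bar>g' x\<bar>"
        using K by (simp add: power2_diff field_simps power2_eq_square)
      finally show "norm (g' x) \<le> K / 2 + (g' x)\<^sup>2 / (2 * K)" by simp
    qed
    also have "\<dots> = K * (v - u) / 2 + integral {u..v} (\<lambda>x. (g' x)\<^sup>2) / (2 * K)"
      using uv int' by (subst integral_add) (auto intro: integrable_on_divide)
    also have "\<dots> \<le> K * l / 2 + integral {a..b} (\<lambda>x. (g' x)\<^sup>2) / (2 * K)"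
      using uv K by (intro add_mono divide_right_mono mult_left_mono integral_subset_le int') auto
    finally show ?thesis using bound eq(1) by simp
  qed
  show ?thesis
  proof (cases "z + l \<le> b")
    case True
    have "\<bar>g x\<bar> \<le> \<eta>" if "x \<in> {z..z + l}" for x using main[of z x] that z True by auto
    thus ?thesis using z True by blast
  next
    case False
    have "\<bar>g x\<bar> \<le> \<eta>" if "x \<in> {z - l..z - l + l}" for x using main[of x z] that z False l by auto
    thus ?thesis using z False l by (intro exI[of _ "z - l"]) auto
  qed
qed

section \<open>Zeros of the Fekete polynomial on the unit circle\<close>

text \<open>Let \<open>F\<close> be the sum of \<open>(k / p) cis (2 \<pi> (k - p / 2) x)\<close>, that is, the Fekete polynomial on the circle
  with its frequencies moved to a range symmetric about \<open>0\<close>. It is real-valued if \<open>- 1\<close> is a square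
  modulo \<open>p\<close> and purely imaginary otherwise, so \<open>Re F + Im F\<close> is, in both cases, a real function whose
  absolute value is \<open>\<bar>F\<bar>\<close>.\<close>

definition hartley_fekete :: "nat \<Rightarrow> real \<Rightarrow> real" where
  "hartley_fekete p x = (\<Sum>k = 1..p - 1. of_int (Legendre (int k) (int p)) *
     (cos (2 * pi * (real k - real p / 2) * x) + sin (2 * pi * (real k - real p / 2) * x)))"

definition hartley_fekete_deriv :: "nat \<Rightarrow> real \<Rightarrow> real" where
  "hartley_fekete_deriv p x = (\<Sum>k = 1..p - 1. of_int (Legendre (int k) (int p)) *
     (2 * pi * (real k - real p / 2)) *
     (cos (2 * pi * (real k - real p / 2) * x) - sin (2 * pi * (real k - real p / 2) * x)))"

lemma hartley_fekete_has_derivative: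
  "(hartley_fekete p has_real_derivative hartley_fekete_deriv p x) (at x)"
  unfolding hartley_fekete_def hartley_fekete_deriv_def
  by (auto intro!: derivative_eq_intros sum.cong simp: algebra_simps)

lemma continuous_hartley_fekete: "continuous_on S (hartley_fekete p)"
  unfolding hartley_fekete_def by (intro continuous_intros)

lemma continuous_hartley_fekete_deriv: "continuous_on S (hartley_fekete_deriv p)"
  unfolding hartley_fekete_deriv_def by (intro continuous_intros)

abbreviation centred_fekete :: "nat \<Rightarrow> real \<Rightarrow> complex" where
  "centred_fekete p x \<equiv> (\<Sum>k = 1..p - 1. of_int (Legendre (int k) (int p)) *
     cis (2 * pi * (real k - real p / 2) * x))"

lemma hartley_fekete_Re_Im: "hartley_fekete p x = Re (centred_fekete p x) + Im (centred_fekete p x)"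
  by (simp add: hartley_fekete_def sum.distrib distrib_left)

lemma centred_fekete_shifted_fekete:
  assumes "p > 0"
  shows "centred_fekete p x = cis (- pi * real p * x) * poly (shifted_fekete 0 p) (cis (2 * pi * x))"
proof -
  have "poly (shifted_fekete 0 p) (cis (2 * pi * x))
      = (\<Sum>k = 0..p - 1. of_int (Legendre (int k) (int p)) * cis (2 * pi * x) ^ k)"
    by (simp add: shifted_fekete_def poly_sum poly_monom)
  also have "\<dots> = (\<Sum>k = 1..p - 1. of_int (Legendre (int k) (int p)) * cis (2 * pi * x) ^ k)"
    by (rule sum.mono_neutral_right) (auto simp: Legendre_def not_less_eq_eq)
  finally have P: "poly (shifted_fekete 0 p) (cis (2 * pi * x))
      = (\<Sum>k = 1..p - 1. of_int (Legendre (int k) (int p)) * cis (2 * pi * x) ^ k)" .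
  have "cis (2 * pi * (real k - real p / 2) * x) = cis (- pi * real p * x) * cis (2 * pi * x) ^ k" for k
    unfolding Complex.DeMoivre cis_mult by (rule arg_cong[of _ _ cis]) (simp add: algebra_simps)
  thus ?thesis unfolding P sum_distrib_left by (simp only: mult_ac)
qed

text \<open>Conjugation reverses the frequencies, which amounts to \<open>k \<mapsto> p - k\<close> and multiplies the Legendre
  symbol by its value at \<open>- 1\<close>.\<close>

lemma cnj_centred_fekete:
  assumes p: "prime p" "2 < p"
  shows "cnj (centred_fekete p x) = of_int (Legendre (- 1) (int p)) * centred_fekete p x"
proof -
  have "cnj (centred_fekete p x) = (\<Sum>k = 1..p - 1. of_int (Legendre (int k) (int p)) *
     cis (- (2 * pi * (real k - real p / 2) * x)))" by (simp add: cnj_sum cis_cnj)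
  also have "\<dots> = (\<Sum>k = 1..p - 1. of_int (Legendre (int (p - k)) (int p)) *
     cis (2 * pi * (real k - real p / 2) * x))"
    by (rule sum.reindex_bij_witness[of _ "\<lambda>k. p - k" "\<lambda>k. p - k"])
       (use p in \<open>auto simp: of_nat_diff algebra_simps\<close>)
  also have "\<dots> = (\<Sum>k = 1..p - 1. of_int (Legendre (- 1) (int p)) * (of_int (Legendre (int k) (int p)) *
     cis (2 * pi * (real k - real p / 2) * x)))"
  proof (intro sum.cong refl)
    fix k assume k: "k \<in> {1..p - 1}"
    hence "k \<le> p" by auto
    hence "Legendre (int (p - k)) p = Legendre ((- 1) * int k) p"
      by (intro Legendre_cong) (simp add: of_nat_diff cong_iff_dvd_diff)
    thus "of_int (Legendre (int (p - k)) (int p)) * cis (2 * pi * (real k - real p / 2) * x) =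
      of_int (Legendre (- 1) (int p)) * (of_int (Legendre (int k) (int p)) *
       cis (2 * pi * (real k - real p / 2) * x))"
      using Legendre_mult[OF p, of "-1" "int k"] by simp
  qed
  also have "\<dots> = of_int (Legendre (- 1) (int p)) * centred_fekete p x"
    by (simp only: sum_distrib_left)
  finally show ?thesis .
qed

lemma abs_hartley_fekete:
  assumes p: "prime p" "2 < p"
  shows "\<bar>hartley_fekete p x\<bar> = cmod (poly (shifted_fekete 0 p) (cis (2 * pi * x)))"
proof -
  let ?F = "centred_fekete p x"
  have "Legendre (- 1) (int p) \<noteq> 0" using p
    by (auto simp: Legendre_def cong_0_iff)
  hence "Legendre (- 1) (int p) = 1 \<or> Legendre (- 1) (int p) = - 1" using Legendre_cases by blast
  hence "cnj ?F = ?F \<or> cnj ?F = - ?F" using cnj_centred_fekete[OF p, of x] by auto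
  moreover have "\<bar>Re z + Im z\<bar> = cmod z" if "cnj z = z \<or> cnj z = - z" for z
  proof -
    have "Im z = 0 \<or> Re z = 0" using that by (auto simp: complex_eq_iff)
    thus ?thesis using cmod_eq_Re cmod_eq_Im by auto
  qed
  ultimately have "\<bar>Re ?F + Im ?F\<bar> = cmod ?F" by blast
  also have "\<dots> = cmod (poly (shifted_fekete 0 p) (cis (2 * pi * x)))"
    using p by (simp only: centred_fekete_shifted_fekete[of p] norm_mult norm_cis mult_1_left)
  finally show ?thesis by (simp only: hartley_fekete_Re_Im)
qed

text \<open>The uncentred Fekete polynomial agrees at the two neighbouring roots of unity, while the centring
  factor \<open>cis (- \<pi> p x)\<close> changes sign over an interval of length \<open>1 / p\<close>.\<close>

lemma hartley_fekete_sign_change: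
  fixes p j x :: nat
  assumes p: "prime p" "2 < p" and x: "\<not> p dvd x"
    and step: "[Suc j = j * x\<^sup>2] (mod p)"
  shows "hartley_fekete p (real (Suc j) / real p) = - hartley_fekete p (real j / real p)"
proof -
  have *: "centred_fekete p (real i / real p) = cis (- (pi * real i)) *
     (\<Sum>k = 1..p - 1. of_int (Legendre (int k) (int p)) * cis (2 * pi * (real k * real i / real p)))" for i
  proof -
    have "cis (2 * pi * (real k - real p / 2) * (real i / real p))
        = cis (- (pi * real i)) * cis (2 * pi * (real k * real i / real p))" for k
      unfolding cis_mult by (rule arg_cong[of _ _ cis]) (use p in \<open>simp add: field_simps\<close>)
    thus ?thesis unfolding sum_distrib_left by (simp only: mult_ac)
  qed
  have "- (pi * real (Suc j)) = - (pi * real j) - pi" by (simp add: algebra_simps)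
  hence "cis (- (pi * real (Suc j))) = - cis (- (pi * real j))"
    by (simp only: cis_divide[symmetric] cis_pi) simp
  hence "centred_fekete p (real (Suc j) / real p) = - centred_fekete p (real j / real p)"
    unfolding * fekete_at_roots_of_unity[OF assms] by simp
  thus ?thesis by (simp only: hartley_fekete_Re_Im) simp
qed

text \<open>By Parseval: fewer than \<open>p\<close> frequencies, each at most \<open>\<pi> p\<close> in absolute value. The constant \<open>32\<close> is
  \<open>2 \<pi>\<^sup>2\<close> with \<open>\<pi> < 4\<close>, the factor \<open>2\<close> coming from \<open>(u - v)\<^sup>2 \<le> 2 (u\<^sup>2 + v\<^sup>2)\<close>.\<close>

lemma integral_hartley_fekete_deriv_le:
  assumes "p > 0"
  shows "integral {0..1} (\<lambda>x. (hartley_fekete_deriv p x)\<^sup>2) \<le> 32 * real p ^ 3"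
proof -
  define w where "w = (\<lambda>k. 2 * pi * (real k - real p / 2))"
  define a where "a = (\<lambda>k. complex_of_real (of_int (Legendre (int k) (int p)) * w k))"
  let ?Z = "\<lambda>x. \<Sum>k = 1..p - 1. a k * cis (2 * pi * (real k - real p / 2) * x)"
  have Z: "((\<lambda>x. (cmod (?Z x))\<^sup>2) has_integral (\<Sum>k = 1..p - 1. (cmod (a k))\<^sup>2)) {0..1}"
    by (rule parseval_cis) simp
  have le: "(hartley_fekete_deriv p x)\<^sup>2 \<le> 2 * (cmod (?Z x))\<^sup>2" for x
  proof -
    have "hartley_fekete_deriv p x = Re (?Z x) - Im (?Z x)"
      by (simp add: hartley_fekete_deriv_def a_def w_def sum_subtractf right_diff_distrib)
    moreover have "(Re z - Im z)\<^sup>2 \<le> 2 * (cmod z)\<^sup>2" for z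
    proof -
      have "0 \<le> (Re z + Im z)\<^sup>2" by simp
      thus ?thesis unfolding cmod_power2 power2_sum power2_diff by (simp add: algebra_simps)
    qed
    ultimately show ?thesis by (simp only:)
  qed
  have "integral {0..1} (\<lambda>x. (hartley_fekete_deriv p x)\<^sup>2) \<le> integral {0..1} (\<lambda>x. 2 * (cmod (?Z x))\<^sup>2)"
    using Z le continuous_hartley_fekete_deriv
    by (intro integral_le integrable_continuous_interval continuous_intros) auto
  also have "\<dots> = 2 * (\<Sum>k = 1..p - 1. (cmod (a k))\<^sup>2)"
    using integral_unique[OF Z] by simp
  also have "(\<Sum>k = 1..p - 1. (cmod (a k))\<^sup>2) \<le> (\<Sum>k = 1..p - 1. 16 * (real p)\<^sup>2)"
  proof (rule sum_mono)
    fix k assume k: "k \<in> {1..p - 1}"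
    have "\<bar>real_of_int (Legendre (int k) (int p))\<bar> \<le> 1" using Legendre_cases[of k p] by auto
    moreover have "\<bar>w k\<bar> \<le> 4 * real p"
    proof -
      have "\<bar>w k\<bar> = 2 * pi * \<bar>real k - real p / 2\<bar>" by (simp add: w_def abs_mult)
      also have "real k \<le> real p" using k by auto
      hence "\<bar>real k - real p / 2\<bar> \<le> real p / 2" unfolding abs_le_iff by linarith
      hence "2 * pi * \<bar>real k - real p / 2\<bar> \<le> 2 * 4 * (real p / 2)"
        using pi_less_4 by (intro mult_mono) auto
      finally show ?thesis by simp
    qed
    ultimately have "cmod (a k) \<le> 1 * (4 * real p)"
      unfolding a_def norm_of_real abs_mult by (intro mult_mono) auto
    from power_mono[OF this, of 2] show "(cmod (a k))\<^sup>2 \<le> 16 * (real p)\<^sup>2"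
      by (simp add: power_mult_distrib)
  qed
  also have "\<dots> = 16 * real (p - 1) * (real p)\<^sup>2" by simp
  also have "\<dots> \<le> 16 * real p * (real p)\<^sup>2" by (intro mult_right_mono) auto
  finally show ?thesis by (simp add: power2_eq_square power3_eq_cube)
qed

lemma sum_integral_grid:
  fixes h :: "real \<Rightarrow> real"
  assumes h: "continuous_on UNIV h" and p: "p > 0"
  shows "(\<Sum>j<n. integral {real j / real p..real (Suc j) / real p} h) = integral {0..real n / real p} h"
proof (induction n)
  case (Suc n)
  have "integral {0..real n / real p} h + integral {real n / real p..real (Suc n) / real p} h
      = integral {0..real (Suc n) / real p} h"
    using p by (intro Henstock_Kurzweil_Integration.integral_combine integrable_continuous_interval
                 continuous_on_subset[OF h]) (auto simp: field_simps)
  thus ?case using Suc by simp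
qed simp

text \<open>Each arc between neighbouring \<open>p\<close>-th roots of unity with a sign change on which the squared derivative
  has integral \<open>D j \<le> 256 p\<^sup>2\<close> contains an interval of length \<open>1 / (16384 p)\<close> where the polynomial is at
  most \<open>sqrt p / 8\<close>. The linear bound \<open>(1 - D j / (256 p\<^sup>2)) / (16384 p)\<close> for the measure of the small
  set inside arc \<open>j\<close> holds on every arc with a sign change, as it is negative for larger \<open>D j\<close>,
  so it can be summed without first selecting arcs: there are at least \<open>p / 4\<close> sign changes, and the
  derivative terms cost at most \<open>32 p\<^sup>3 / (256 p\<^sup>2) = p / 8\<close>, which leaves \<open>p / 8\<close>.\<close>

lemma fekete_small_on_large_set:
  assumes p: "prime p" "7 \<le> p"
  shows "1 / 2 ^ 17 \<le> measure lborel {x\<in>{0..1}. cmod (poly (shifted_fekete 0 p) (cis (2 * pi * x))) \<le> sqrt p / 8}"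
proof -
  define E where "E = {x\<in>{0..1}. \<bar>hartley_fekete p x\<bar> \<le> sqrt p / 8}"
  define J where "J = {j \<in> {..<p}. \<exists>x. \<not> p dvd x \<and> [Suc j = j * x\<^sup>2] (mod p)}"
  define I where "I = (\<lambda>j. {real j / real p..<real (Suc j) / real p})"
  define D where "D = (\<lambda>j. integral {real j / real p..real (Suc j) / real p} (\<lambda>x. (hartley_fekete_deriv p x)\<^sup>2))"
  have p0: "real p > 0" and p2: "2 < p" using p by auto
  have sq: "sqrt p * sqrt p = real p" "sqrt p > 0" using p0 by auto
  have cont2: "continuous_on UNIV (\<lambda>x. (hartley_fekete_deriv p x)\<^sup>2)"
    by (intro continuous_intros continuous_hartley_fekete_deriv)
  have D0: "D j \<ge> 0" for j
    unfolding D_def by (intro integral_nonneg integrable_continuous_interval continuous_on_subset[OF cont2]) auto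
  have "(\<lambda>x. \<bar>hartley_fekete p x\<bar>) \<in> borel_measurable borel"
    by (intro borel_measurable_continuous_onI continuous_intros continuous_hartley_fekete)
  hence "{x \<in> space borel. \<bar>hartley_fekete p x\<bar> \<le> sqrt p / 8} \<in> sets borel" by measurable
  hence "{0..1} \<inter> {x \<in> space borel. \<bar>hartley_fekete p x\<bar> \<le> sqrt p / 8} \<in> sets borel" by (intro sets.Int) auto
  also have "{0..1} \<inter> {x \<in> space borel. \<bar>hartley_fekete p x\<bar> \<le> sqrt p / 8} = E" by (auto simp: E_def)
  finally have E[measurable]: "E \<in> sets borel" .
  have Efm: "E \<in> fmeasurable lborel"
    by (rule fmeasurableI2[OF fmeasurable_cbox[of 0 1]]) (use E in \<open>auto simp: E_def\<close>)
  have EI: "E \<inter> I j \<in> fmeasurable lborel" for j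
    by (rule fmeasurableI2[OF Efm]) (auto simp: I_def)
  have arc: "1 / (16384 * real p) * (1 - D j / (256 * (real p)\<^sup>2)) \<le> measure lborel (E \<inter> I j)" if j: "j \<in> J" for j
  proof (cases "D j \<le> 256 * (real p)\<^sup>2")
    case False
    hence "1 - D j / (256 * (real p)\<^sup>2) \<le> 0" using p0 by (simp add: field_simps)
    hence "1 / (16384 * real p) * (1 - D j / (256 * (real p)\<^sup>2)) \<le> 0"
      using p0 by (intro mult_nonneg_nonpos) auto
    also have "0 \<le> measure lborel (E \<inter> I j)" by simp
    finally show ?thesis .
  next
    case True
    define l where "l = 1 / (16384 * real p)"
    \<comment> \<open>This \<open>K\<close> makes each of the two terms of the bound at most \<open>sqrt p / 16\<close>.\<close>
    define K where "K = 2048 * real p * sqrt p"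
    obtain x where x: "\<not> p dvd x" "[Suc j = j * x\<^sup>2] (mod p)" using j by (auto simp: J_def)
    have "K * l / 2 + D j / (2 * K) \<le> sqrt p / 8"
    proof -
      have "K * l / 2 = sqrt p / 16" using p0 by (simp add: K_def l_def)
      moreover have "D j / (2 * K) \<le> 256 * (real p)\<^sup>2 / (2 * K)"
        using True sq p0 by (intro divide_right_mono) (auto simp: K_def)
      moreover have "256 * (real p)\<^sup>2 / (2 * K) = sqrt p / 16"
        using sq p0 by (simp add: K_def field_simps power2_eq_square)
      ultimately show ?thesis by linarith
    qed
    hence "\<exists>c\<ge>real j / real p. c + l \<le> real (Suc j) / real p \<and> (\<forall>x\<in>{c..c + l}. \<bar>hartley_fekete p x\<bar> \<le> sqrt p / 8)"
      using sq p0 unfolding D_def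
      by (intro small_near_sign_change[where K = K, OF hartley_fekete_has_derivative
                   continuous_hartley_fekete_deriv hartley_fekete_sign_change[OF p(1) p2 x]])
         (auto simp: K_def l_def field_simps)
    then obtain c where c: "real j / real p \<le> c" "c + l \<le> real (Suc j) / real p"
      "\<forall>x\<in>{c..c + l}. \<bar>hartley_fekete p x\<bar> \<le> sqrt p / 8" by blast
    have "real (Suc j) / real p \<le> 1" using j p0 by (auto simp: J_def field_simps)
    moreover have "0 \<le> real j / real p" by simp
    ultimately have "0 \<le> c" "c + l \<le> 1" using c by linarith+
    hence "{c..<c + l} \<subseteq> E \<inter> I j" using c by (auto simp: E_def I_def)
    moreover have "l > 0" using p0 by (simp add: l_def)
    ultimately have "l \<le> measure lborel (E \<inter> I j)"
      using measure_mono_fmeasurable[OF _ _ EI, of "{c..<c+l}" j] by simp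
    moreover have "l * (1 - D j / (256 * (real p)\<^sup>2)) \<le> l * 1"
      using \<open>l > 0\<close> D0[of j] by (intro mult_left_mono) auto
    ultimately show ?thesis unfolding l_def by linarith
  qed
  have J: "finite J" "J \<subseteq> {..<p}" by (auto simp: J_def)
  have "(real p - 3) / 2 \<le> real (card J)"
  proof -
    have "odd p" using p p2 prime_odd_nat by blast
    then obtain b where b: "p = Suc (2 * b)" by (auto elim: oddE)
    hence "p - 3 = 2 * (b - 1)" by simp
    hence "(real p - 3) / 2 = real ((p - 3) div 2)" using p(2) b by (simp add: of_nat_diff)
    also have "\<dots> \<le> real (card J)" unfolding J_def using many_square_steps[OF p(1) p2] by simp
    finally show ?thesis .
  qed
  moreover have "(\<Sum>j\<in>J. D j) \<le> 32 * real p ^ 3"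
  proof -
    have "(\<Sum>j\<in>J. D j) \<le> (\<Sum>j<p. D j)" using J D0 by (intro sum_mono2) auto
    also have "\<dots> = integral {0..1} (\<lambda>x. (hartley_fekete_deriv p x)\<^sup>2)"
      unfolding D_def using sum_integral_grid[OF cont2, of p p] p0 by simp
    finally show ?thesis using integral_hartley_fekete_deriv_le[of p] p0 by simp
  qed
  ultimately have "(real p / 4 - 32 * real p ^ 3 / (256 * (real p)\<^sup>2)) \<le> real (card J) - (\<Sum>j\<in>J. D j) / (256 * (real p)\<^sup>2)"
    using p(2) p0 by (intro diff_mono divide_right_mono) auto
  moreover have "32 * real p ^ 3 / (256 * (real p)\<^sup>2) = real p / 8"
    using p0 by (simp add: field_simps power2_eq_square power3_eq_cube)
  ultimately have "real p / 8 \<le> real (card J) - (\<Sum>j\<in>J. D j) / (256 * (real p)\<^sup>2)" by simp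
  hence "1 / (16384 * real p) * (real p / 8) \<le> 1 / (16384 * real p) * (real (card J) - (\<Sum>j\<in>J. D j) / (256 * (real p)\<^sup>2))"
    using p0 by (intro mult_left_mono) auto
  also have "\<dots> = (\<Sum>j\<in>J. 1 / (16384 * real p) * (1 - D j / (256 * (real p)\<^sup>2)))"
    by (simp only: sum_distrib_left[symmetric] sum_subtractf sum_divide_distrib) simp
  also have "\<dots> \<le> (\<Sum>j\<in>J. measure lborel (E \<inter> I j))" by (intro sum_mono arc)
  also have "\<dots> = measure lborel (\<Union>j\<in>J. E \<inter> I j)"
  proof (rule measure_finite_Union[symmetric])
    show "disjoint_family_on (\<lambda>j. E \<inter> I j) J"
    proof -
      have "I i \<inter> I j = {}" if "i < j" for i j
      proof -
        have "real (Suc i) / real p \<le> real j / real p" using that p0 by (intro divide_right_mono) auto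
        thus ?thesis by (auto simp: I_def)
      qed
      hence "I i \<inter> I j = {}" if "i \<noteq> j" for i j using that by (cases i j rule: linorder_cases) blast+
      thus ?thesis unfolding disjoint_family_on_def by blast
    qed
  qed (use J EI in \<open>auto simp: fmeasurable_def top.not_eq_extremum\<close>)
  also have "\<dots> \<le> measure lborel E"
  proof (rule measure_mono_fmeasurable[OF _ _ Efm])
    show "(\<Union>j\<in>J. E \<inter> I j) \<in> sets lborel"
      by (intro sets.finite_UN J(1) fmeasurableD[OF EI])
  qed auto
  finally have "1 / 2 ^ 17 \<le> measure lborel E" using p0 by simp
  thus ?thesis by (simp only: E_def abs_hartley_fekete[OF p(1) p2])
qed

section \<open>The measure on the unit circle\<close>

lemma circle_param_measurable: "(\<lambda>x. cis (2 * pi * x)) \<in> borel_measurable (restrict_space lborel {0..1})"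
proof -
  have "(\<lambda>x. cis (2 * pi * x)) \<in> borel_measurable borel"
    by (intro borel_measurable_continuous_onI continuous_intros)
  thus ?thesis by (intro measurable_restrict_space1) simp
qed

lemma sets_circle_measure [simp]: "sets circle_measure = sets borel"
  by (simp add: circle_measure_def)

lemma measurable_circle_measure: "borel_measurable circle_measure = borel_measurable borel"
  by (intro measurable_cong_sets) simp_all

lemma space_circle_measure [simp]: "space circle_measure = UNIV"
  by (simp add: circle_measure_def)

lemma integral_circle_measure:
  fixes f :: "complex \<Rightarrow> real"
  assumes "f \<in> borel_measurable borel"
  shows "(\<integral>z. f z \<partial>circle_measure) = (\<integral>x\<in>{0..1}. f (cis (2 * pi * x)) \<partial>lborel)"
  unfolding circle_measure_def set_lebesgue_integral_def
  by (subst integral_distr[OF circle_param_measurable assms], subst integral_restrict_space) auto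

lemma integrable_circle_measure_iff:
  fixes f :: "complex \<Rightarrow> real"
  assumes "f \<in> borel_measurable borel"
  shows "integrable circle_measure f \<longleftrightarrow> set_integrable lborel {0..1} (\<lambda>x. f (cis (2 * pi * x)))"
  unfolding circle_measure_def set_integrable_def
  by (subst integrable_distr_eq[OF circle_param_measurable assms], subst integrable_restrict_space) auto

lemma emeasure_circle_measure:
  assumes "A \<in> sets borel"
  shows "emeasure circle_measure A = emeasure lborel {x\<in>{0..1}. cis (2 * pi * x) \<in> A}"
  unfolding circle_measure_def
  by (subst emeasure_distr[OF circle_param_measurable assms], subst emeasure_restrict_space)
     (auto simp: space_restrict_space intro!: arg_cong[of _ _ "emeasure lborel"])

lemma measure_circle_measure:
  "A \<in> sets borel \<Longrightarrow> measure circle_measure A = measure lborel {x\<in>{0..1}. cis (2 * pi * x) \<in> A}"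
  by (simp add: measure_def emeasure_circle_measure)

lemma Collect_atLeastAtMost: "{x. a \<le> x \<and> x \<le> b} = {a..b}" for a b :: real
  by auto

lemma finite_measure_circle_measure: "finite_measure circle_measure"
  by (rule finite_measureI) (simp add: emeasure_circle_measure Collect_atLeastAtMost)

lemma measure_circle_measure_UNIV: "measure circle_measure UNIV = 1"
  by (simp add: measure_circle_measure Collect_atLeastAtMost)

lemma AE_circle_measure_sphere: "AE z in circle_measure. cmod z = 1"
proof (rule AE_I)
  show "{z \<in> space circle_measure. cmod z \<noteq> 1} \<subseteq> - sphere 0 1" by (auto simp: dist_norm)
  show "emeasure circle_measure (- sphere 0 1) = 0"
    by (subst emeasure_circle_measure) auto
qed simp

lemma emeasure_circle_measure_singleton: "emeasure circle_measure {a} = 0"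
proof -
  let ?A = "{x\<in>{0..1}. cis (2 * pi * x) \<in> {a}}"
  have "countable ?A"
  proof (cases "?A = {}")
    case False
    then obtain c where c: "cis (2 * pi * c) = a" by auto
    have "?A \<subseteq> range (\<lambda>n::int. c + of_int n)"
    proof
      fix x assume "x \<in> ?A"
      hence "cis (2 * pi * x) = cis (2 * pi * c)" using c by simp
      hence "cos (2 * pi * x) = cos (2 * pi * c) \<and> sin (2 * pi * x) = sin (2 * pi * c)"
        by (simp add: complex_eq_iff)
      then obtain n :: int where "2 * pi * x = 2 * pi * c + 2 * pi * n"
        using sin_cos_eq_iff[of "2 * pi * x" "2 * pi * c"] by auto
      hence "2 * pi * x = 2 * pi * (c + n)" by (simp add: distrib_left)
      thus "x \<in> range (\<lambda>n::int. c + of_int n)" by simp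
    qed
    thus ?thesis by (rule countable_subset) simp
  next
    case True
    show ?thesis unfolding True by simp
  qed
  thus ?thesis by (simp add: emeasure_circle_measure emeasure_lborel_countable)
qed

lemma AE_circle_measure_poly_nonzero:
  assumes "P \<noteq> 0"
  shows "AE z in circle_measure. poly P z \<noteq> 0"
proof -
  have "AE z in circle_measure. \<forall>a\<in>{a. poly P a = 0}. z \<noteq> a"
  proof (rule AE_finite_allI)
    fix a
    show "AE z in circle_measure. z \<noteq> a"
      by (rule AE_I[of _ _ "{a}"]) (auto simp: emeasure_circle_measure_singleton)
  qed (use poly_roots_finite[OF assms] in simp)
  thus ?thesis by eventually_elim auto
qed

lemma poly_measurable: "(\<lambda>z. poly P z :: complex) \<in> borel_measurable borel"
  by (intro borel_measurable_continuous_onI continuous_intros)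

lemma integrable_circle_measure_bounded:
  fixes f :: "complex \<Rightarrow> real"
  assumes "f \<in> borel_measurable borel" "\<And>z. cmod z = 1 \<Longrightarrow> \<bar>f z\<bar> \<le> B"
  shows "integrable circle_measure f"
proof -
  interpret finite_measure circle_measure by (rule finite_measure_circle_measure)
  show ?thesis
  proof (rule integrable_const_bound)
    show "AE z in circle_measure. norm (f z) \<le> B"
      using AE_circle_measure_sphere by eventually_elim (use assms(2) in auto)
    show "f \<in> borel_measurable circle_measure"
      using assms(1) by (simp add: measurable_circle_measure)
  qed
qed

lemma integrable_circle_measure_continuous:
  fixes f :: "complex \<Rightarrow> real"
  assumes "f \<in> borel_measurable borel" "continuous_on (sphere 0 1) f"
  shows "integrable circle_measure f"
proof -
  have "bounded (f ` sphere 0 1)"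
    by (intro compact_imp_bounded compact_continuous_image assms) simp
  then obtain B where "\<forall>z\<in>sphere 0 1. \<bar>f z\<bar> \<le> B"
    unfolding bounded_iff by auto
  hence "\<bar>f z\<bar> \<le> B" if "cmod z = 1" for z using that by (simp add: dist_norm)
  thus ?thesis using assms(1) integrable_circle_measure_bounded by blast
qed

lemma parseval_circle:
  "(\<integral>z. (cmod (\<Sum>k\<in>{0..n}. a k * z ^ k))\<^sup>2 \<partial>circle_measure) = (\<Sum>k\<in>{0..n::nat}. (cmod (a k))\<^sup>2)"
proof -
  let ?h = "\<lambda>x. (cmod (\<Sum>k\<in>{0..n}. a k * cis (2 * pi * x) ^ k))\<^sup>2"
  have "(\<lambda>z. (cmod (\<Sum>k\<in>{0..n}. a k * z ^ k))\<^sup>2) \<in> borel_measurable borel"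
    by (intro borel_measurable_continuous_onI continuous_intros)
  hence "(\<integral>z. (cmod (\<Sum>k\<in>{0..n}. a k * z ^ k))\<^sup>2 \<partial>circle_measure) = (\<integral>x\<in>{0..1}. ?h x \<partial>lborel)"
    by (rule integral_circle_measure)
  also have "\<dots> = integral {0..1} ?h"
    by (intro set_borel_integral_eq_integral borel_integrable_atLeastAtMost' continuous_intros)
  also have "?h = (\<lambda>x. (cmod (\<Sum>k\<in>{0..n}. a k * cis (2 * pi * (real k - 0) * x)))\<^sup>2)"
    by (simp add: Complex.DeMoivre mult_ac)
  also have "integral {0..1} \<dots> = (\<Sum>k\<in>{0..n}. (cmod (a k))\<^sup>2)"
    by (intro integral_unique parseval_cis) simp
  finally show ?thesis .
qed

section \<open>Integrability of the logarithm of a polynomial\<close>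

text \<open>A lower bound for a chord of the circle by its arc, obtained from \<open>sin y = 2 sin (y / 2) cos (y / 2)\<close>
  and the mean value theorem on \<open>{0..y / 2}\<close>, where the cosine is at least \<open>sqrt 2 / 2\<close>.\<close>

lemma half_le_sin:
  assumes "\<bar>y\<bar> \<le> pi / 2"
  shows "\<bar>y\<bar> \<le> 2 * \<bar>sin y\<bar>"
proof -
  have *: "y \<le> 2 * sin y" if y: "0 < y" "y \<le> pi / 2" for y :: real
  proof -
    have cos: "cos x \<ge> sqrt 2 / 2" if "0 \<le> x" "x \<le> y / 2" for x
      using cos_monotone_0_pi_le[of x "pi / 4"] that y by (simp add: cos_45)
    obtain x where x: "0 < x" "x < y / 2" "sin (y / 2) - sin 0 = (y / 2 - 0) * cos x"
      using MVT2[of 0 "y / 2" sin cos] y by auto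
    have "(y / 2) * (sqrt 2 / 2) \<le> (y / 2) * cos x" using x cos[of x] y
      by (intro mult_left_mono) auto
    hence "sqrt 2 / 2 * (y / 2) \<le> sin (y / 2)" using x(3) by (simp add: mult.commute)
    hence "(sqrt 2 / 2 * (y / 2)) * (sqrt 2 / 2) \<le> sin (y / 2) * cos (y / 2)"
      using cos[of "y / 2"] y sin_gt_zero[of "y / 2"] by (intro mult_mono) auto
    moreover have "(sqrt 2 / 2 * (y / 2)) * (sqrt 2 / 2) = y / 4" by (simp add: field_simps)
    moreover have "sin y = 2 * (sin (y / 2) * cos (y / 2))" using sin_double[of "y / 2"] by simp
    ultimately show ?thesis by linarith
  qed
  show ?thesis using *[of y] *[of "- y"] assms
    by (cases "y = 0"; cases "y > 0") auto
qed

lemma integrable_inverse_sqrt_abs: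
  "integrable lborel (\<lambda>t::real. indicator {-3..3} t * \<bar>t\<bar> powr (- 1 / 2))"
proof -
  define u where "u = (\<lambda>t::real. indicator {0..3} t * t powr (- 1 / 2))"
  have "(\<lambda>t::real. t powr (- 1 / 2)) absolutely_integrable_on {0..3}"
    by (intro nonnegative_absolutely_integrable_1 integrable_on_powr_from_0) auto
  hence "integrable lebesgue u" by (simp add: u_def set_integrable_def)
  moreover have meas: "u \<in> borel_measurable borel" unfolding u_def by measurable
  ultimately have u: "integrable lborel u" by (simp add: integrable_completion)
  have "integrable lborel (\<lambda>t. u t + u (0 + (- 1) * t))"
    by (intro Bochner_Integration.integrable_add u lborel_integrable_real_affine) auto
  thus ?thesis
    by (rule Bochner_Integration.integrable_bound) (auto simp: u_def indicator_def)
qed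

lemma abs_ln_le:
  fixes t v :: real
  assumes "0 < t" "t \<le> v" "v \<le> 2"
  shows "\<bar>ln v\<bar> \<le> 1 + 2 * t powr (- 1 / 2)"
proof (cases "v \<ge> 1")
  case True
  hence "\<bar>ln v\<bar> \<le> 1" using ln_le_minus_one[of v] assms by auto
  thus ?thesis by (smt (verit) powr_ge_zero)
next
  case False
  have "- ln v = 2 * ln (v powr (- 1 / 2))" using assms by (simp add: ln_powr)
  also have "ln (v powr (- 1 / 2)) \<le> v powr (- 1 / 2)"
    using ln_le_minus_one[of "v powr (- 1 / 2)"] assms by simp
  also have "\<dots> \<le> t powr (- 1 / 2)" using assms by (intro powr_mono2') auto
  finally show ?thesis using False assms by (simp add: ln_le_zero_iff)
qed

text \<open>Close to \<open>a\<close> the logarithm is dominated, up to a constant, by \<open>2 \<bar>t\<bar> powr (- 1 / 2)\<close>, where \<open>t\<close> is the parameter distance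
  to \<open>a\<close> modulo \<open>1\<close>. The sum over \<open>k\<close> in the dominating function accounts for the representatives of
  \<open>a\<close> in the three periods that a parameter in \<open>{0..1}\<close> can be closest to.\<close>

lemma integrable_ln_dist:
  assumes a: "cmod a = 1"
  shows "integrable circle_measure (\<lambda>z. ln (cmod (a - z)))"
proof -
  define c where "c = Arg2pi a / (2 * pi)"
  have ac: "a = cis (2 * pi * c)"
    using Arg2pi_eq[of a] a by (simp add: c_def cis_conv_exp)
  have c: "0 \<le> c" "c < 1" using Arg2pi[of a] by (auto simp: c_def field_simps)
  define u where "u = (\<lambda>t::real. indicator {-3..3} t * \<bar>t\<bar> powr (- 1 / 2))"
  define h where "h = (\<lambda>x. indicator {0..1} x + 2 * (\<Sum>k\<in>{-1..1::int}. u (- c - of_int k + 1 * x)) :: real)"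
  have u0: "u t \<ge> 0" for t by (simp add: u_def)
  have hint: "integrable lborel h" unfolding h_def
    by (intro Bochner_Integration.integrable_add integrable_mult_right Bochner_Integration.integrable_sum
         lborel_integrable_real_affine integrable_inverse_sqrt_abs[folded u_def]) auto
  have meas: "(\<lambda>z. ln (cmod (a - z))) \<in> borel_measurable borel" by measurable
  have "set_integrable lborel {0..1} (\<lambda>x. ln (cmod (a - cis (2 * pi * x))))"
    unfolding set_integrable_def
  proof (rule Bochner_Integration.integrable_bound[OF hint])
    have "(\<lambda>x. cis (2 * pi * x)) \<in> borel_measurable borel"
      by (intro borel_measurable_continuous_onI continuous_intros)
    thus "(\<lambda>x. indicator {0..1} x *\<^sub>R ln (cmod (a - cis (2 * pi * x)))) \<in> borel_measurable lborel"
      by measurable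
    have "\<bar>indicator {0..1} x * ln (cmod (a - cis (2 * pi * x)))\<bar> \<le> h x" for x
    proof (cases "x \<in> {0..1} \<and> cis (2 * pi * x) \<noteq> a")
      case False
      moreover have "0 \<le> h x" using u0 by (auto simp: h_def intro!: add_nonneg_nonneg sum_nonneg)
      ultimately show ?thesis by (auto simp: indicator_def)
    next
      case True
      define k where "k = round (x - c)"
      define t where "t = x - c - of_int k"
      have t: "\<bar>t\<bar> \<le> 1 / 2" using of_int_round_abs_le[of "x - c"] by (simp add: t_def k_def abs_minus_commute)
      have "real_of_int k > - 2" "real_of_int k < 2"
        using t True c unfolding t_def abs_le_iff by auto
      hence k: "k \<in> {-1..1}" by auto
      have "2 * pi * x = 2 * pi * c + 2 * pi * t + 2 * pi * of_int k"
        by (simp add: t_def algebra_simps)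
      hence "cis (2 * pi * x) = a * cis (2 * pi * t)"
        by (simp only: cis_mult[symmetric] cis_2pi_int ac mult_1_right)
      hence "cmod (a - cis (2 * pi * x)) = cmod (a * (cis (2 * pi * t) - 1))"
        by (simp add: right_diff_distrib norm_minus_commute)
      also have "\<dots> = cmod (exp (\<i> * of_real (2 * pi * t)) - 1)"
        using a by (simp add: norm_mult cis_conv_exp)
      also have "\<dots> = 2 * \<bar>sin (pi * t)\<bar>" by (subst dist_exp_i_1) simp
      finally have d: "cmod (a - cis (2 * pi * x)) = 2 * \<bar>sin (pi * t)\<bar>" .
      have "\<bar>pi * t\<bar> \<le> pi / 2" using t by (simp add: abs_mult)
      hence "pi * \<bar>t\<bar> \<le> 2 * \<bar>sin (pi * t)\<bar>" using half_le_sin[of "pi * t"] by (simp add: abs_mult)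
      moreover have "1 * \<bar>t\<bar> \<le> pi * \<bar>t\<bar>" using pi_gt3 by (intro mult_right_mono) auto
      ultimately have low: "\<bar>t\<bar> \<le> cmod (a - cis (2 * pi * x))" using d by linarith
      have "t \<noteq> 0" using d True by auto
      hence "\<bar>ln (cmod (a - cis (2 * pi * x)))\<bar> \<le> 1 + 2 * \<bar>t\<bar> powr (- 1 / 2)"
        using low norm_triangle_ineq4[of a "cis (2 * pi * x)"] a by (intro abs_ln_le) auto
      also have "\<bar>t\<bar> powr (- 1 / 2) = u (- c - of_int k + 1 * x)"
      proof -
        have "- c - of_int k + 1 * x = t" by (simp add: t_def)
        moreover have "t \<in> {-3..3}" using t unfolding abs_le_iff atLeastAtMost_iff by linarith
        ultimately show ?thesis by (simp add: u_def)
      qed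
      also have "\<dots> \<le> (\<Sum>k\<in>{-1..1::int}. u (- c - of_int k + 1 * x))"
        by (rule member_le_sum) (use k u0 in auto)
      finally show ?thesis using True by (simp add: h_def)
    qed
    thus "AE x in lborel. norm (indicator {0..1} x *\<^sub>R ln (cmod (a - cis (2 * pi * x)))) \<le> norm (h x)"
      by (auto intro!: AE_I2 order_trans[OF _ abs_ge_self] simp: abs_mult)
  qed
  thus ?thesis using integrable_circle_measure_iff[OF meas] by simp
qed

text \<open>Splitting off the zeros on the unit circle suffices: what remains has a logarithm that is continuous
  on the circle. Integrability matters because the Bochner integral of a non-integrable function is
  \<open>0\<close>, which would make the Mahler measure equal to \<open>1\<close>.\<close>

lemma integrable_ln_poly:
  assumes "P \<noteq> 0"
  shows "integrable circle_measure (\<lambda>z. ln (cmod (poly P z)))"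
  using assms
proof (induction P rule: poly_root_induct[where P = "\<lambda>a. cmod a = 1"])
  case (no_roots p)
  show ?case
  proof (rule integrable_circle_measure_continuous)
    show "(\<lambda>z. ln (cmod (poly p z))) \<in> borel_measurable borel"
      using poly_measurable[of p] by measurable
    show "continuous_on (sphere 0 1) (\<lambda>z. ln (cmod (poly p z)))"
      using no_roots by (intro continuous_intros) (auto simp: dist_norm)
  qed
next
  case (root a p)
  hence p: "p \<noteq> 0" by auto
  have "integrable circle_measure (\<lambda>z. ln (cmod (a - z)) + ln (cmod (poly p z)))"
    using root p by (intro Bochner_Integration.integrable_add integrable_ln_dist) auto
  moreover have "AE z in circle_measure. ln (cmod (a - z)) + ln (cmod (poly p z)) = ln (cmod (poly ([:a, -1:] * p) z))"
    using AE_circle_measure_poly_nonzero[OF root.prems]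
  proof eventually_elim
    fix z assume "poly ([:a, -1:] * p) z \<noteq> 0"
    moreover have "cmod (poly ([:a, -1:] * p) z) = cmod (a - z) * cmod (poly p z)"
      by (simp add: norm_mult[symmetric] algebra_simps)
    ultimately show "ln (cmod (a - z)) + ln (cmod (poly p z)) = ln (cmod (poly ([:a, -1:] * p) z))"
      by (simp only: ln_mult_pos[symmetric]) (simp add: ln_mult_pos)
  qed
  moreover have "(\<lambda>z. ln (cmod (a - z)) + ln (cmod (poly p z))) \<in> borel_measurable borel"
                "(\<lambda>z. ln (cmod (poly ([:a, -1:] * p) z))) \<in> borel_measurable borel"
    using poly_measurable[of p] poly_measurable[of "[:a, -1:] * p"] by measurable
  ultimately show ?case
    by (subst (asm) integrable_cong_AE) (auto simp: measurable_circle_measure)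
qed simp

section \<open>A criterion against flatness\<close>

text \<open>\<open>ln u\<^sup>2 \<le> u\<^sup>2 - 1\<close> alone shows that the Mahler measure is at most the \<open>L\<^sup>2\<close> norm; the gap
  for \<open>u \<le> 1 / 2\<close> makes this inequality strict, quantitatively.\<close>

lemma ln_le_quadratic_gap:
  fixes u :: real
  assumes "u > 0"
  shows "ln u \<le> (u\<^sup>2 - 1) / 2 - (if u \<le> 1 / 2 then 1 / 4 else 0)"
proof (cases "u \<le> 1 / 2")
  case True
  have "2 * ln (2 * u) = ln ((2 * u)\<^sup>2)" using ln_realpow[of "2 * u" 2] assms by simp
  also have "\<dots> \<le> (2 * u)\<^sup>2 - 1" using assms by (intro ln_le_minus_one) auto
  finally have "2 * ln 2 + 2 * ln u \<le> 4 * u\<^sup>2 - 1" using assms by (simp add: ln_mult_pos)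
  moreover have "u\<^sup>2 \<le> (1 / 2)\<^sup>2" using True assms by (intro power_mono) auto
  hence "u\<^sup>2 \<le> 1 / 4" by (simp add: power2_eq_square)
  ultimately have "ln u \<le> (u\<^sup>2 - 1) / 2 - 1 / 4"
    using ln2_ge_two_thirds by argo
  thus ?thesis using True by simp
next
  case False
  have "2 * ln u = ln (u\<^sup>2)" using assms by (simp add: ln_realpow)
  also have "\<dots> \<le> u\<^sup>2 - 1" using assms by (intro ln_le_minus_one) auto
  finally show ?thesis using False by simp
qed

text \<open>For \<open>\<alpha> > 0\<close> the set where the modulus is at most \<open>1 / 2\<close> contributes at least \<open>c (1 / 2) powr \<alpha>\<close> to the
  integral that should vanish. For \<open>\<alpha> = 0\<close> the normalization and the gap in the inequality between
  the logarithm and the square bound the Mahler measure by \<open>exp (- c / 4)\<close>.\<close>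

lemma not_flat_along_if_often_small:
  fixes P :: "'i \<Rightarrow> complex poly"
  assumes F: "F \<noteq> bot" and \<alpha>: "\<alpha> \<ge> 0" and c: "c > 0"
    and unit: "\<forall>\<^sub>F n in F. (\<integral>z. (cmod (poly (P n) z))\<^sup>2 \<partial>circle_measure) = 1"
    and small: "\<forall>\<^sub>F n in F. c \<le> measure circle_measure {z. cmod (poly (P n) z) \<le> 1 / 2}"
  shows "\<not> flat_along \<alpha> F P"
proof
  assume flat: "flat_along \<alpha> F P"
  interpret finite_measure circle_measure by (rule finite_measure_circle_measure)
  let ?E = "\<lambda>n. {z. cmod (poly (P n) z) \<le> 1 / 2}"
  have E: "?E n \<in> sets circle_measure" for n
  proof -
    have "closed (?E n)" by (intro closed_Collect_le continuous_intros)
    thus ?thesis by (simp add: borel_closed)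
  qed
  have Eint: "integrable circle_measure (indicator (?E n) :: complex \<Rightarrow> real)"
             "(\<integral>z. indicator (?E n) z \<partial>circle_measure) = measure circle_measure (?E n)" for n
    using E[of n] by (auto simp: emeasure_finite less_top[symmetric])
  show False
  proof (cases "\<alpha> = 0")
    case True
    have "\<forall>\<^sub>F n in F. circle_norm 0 (poly (P n)) \<le> exp (- c / 4)"
      using unit small
    proof eventually_elim
      case (elim n)
      let ?q = "\<lambda>z. cmod (poly (P n) z)"
      have nz: "P n \<noteq> 0" using elim(1) by auto
      have sq: "integrable circle_measure (\<lambda>z. (?q z)\<^sup>2)"
        by (intro integrable_circle_measure_continuous borel_measurable_continuous_onI continuous_intros)
      have "AE z in circle_measure. ln (?q z) \<le> ((?q z)\<^sup>2 - 1) / 2 - 1 / 4 * indicator (?E n) z"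
        using AE_circle_measure_poly_nonzero[OF nz]
      proof eventually_elim
        fix z assume "poly (P n) z \<noteq> 0"
        thus "ln (?q z) \<le> ((?q z)\<^sup>2 - 1) / 2 - 1 / 4 * indicator (?E n) z"
          using ln_le_quadratic_gap[of "?q z"] by (auto simp: indicator_def split: if_splits)
      qed
      hence "(\<integral>z. ln (?q z) \<partial>circle_measure)
          \<le> (\<integral>z. ((?q z)\<^sup>2 - 1) / 2 - 1 / 4 * indicator (?E n) z \<partial>circle_measure)"
        using sq Eint(1)[of n]
        by (intro integral_mono_AE integrable_ln_poly nz Bochner_Integration.integrable_diff
              integrable_divide integrable_mult_right integrable_const) auto
      also have "\<dots> = ((\<integral>z. (?q z)\<^sup>2 \<partial>circle_measure) - 1) / 2 - 1 / 4 * measure circle_measure (?E n)"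
        using sq Eint[of n] by (simp add: measure_circle_measure_UNIV)
      also have "\<dots> \<le> - c / 4" using elim by simp
      finally show ?case by (simp add: circle_norm_def)
    qed
    moreover have "((\<lambda>n. circle_norm 0 (poly (P n))) \<longlongrightarrow> 1) F"
      using flat True by (simp add: flat_along_def)
    ultimately have "1 \<le> exp (- c / 4)" using F by (intro tendsto_upperbound)
    thus False using c by simp
  next
    case False
    hence \<alpha>: "\<alpha> > 0" using \<alpha> by simp
    define \<epsilon> where "\<epsilon> = (c * (1 / 2) powr \<alpha>) powr (1 / \<alpha>)"
    have "\<forall>\<^sub>F n in F. \<epsilon> \<le> circle_norm \<alpha> (\<lambda>z. cmod (poly (P n) z) - 1)"
      using small
    proof eventually_elim
      case (elim n)
      let ?d = "\<lambda>z. norm (cmod (poly (P n) z) - 1) powr \<alpha>"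
      have "continuous_on A ?d" for A
        using \<alpha> by (intro continuous_on_powr' continuous_intros) auto
      hence int: "integrable circle_measure ?d"
        by (intro integrable_circle_measure_continuous borel_measurable_continuous_onI)
      have "c * (1 / 2) powr \<alpha> \<le> measure circle_measure (?E n) * (1 / 2) powr \<alpha>"
        using elim by (intro mult_right_mono) auto
      also have "\<dots> = (\<integral>z. indicator (?E n) z * (1 / 2) powr \<alpha> \<partial>circle_measure)"
        using Eint[of n] by simp
      also have "\<dots> \<le> (\<integral>z. ?d z \<partial>circle_measure)"
      proof (intro integral_mono integrable_mult_left Eint(1) int)
        fix z
        show "indicator (?E n) z * (1 / 2) powr \<alpha> \<le> ?d z"
          using \<alpha> by (auto simp: indicator_def intro!: powr_mono2)
      qed
      finally show ?case
        using False c \<alpha> unfolding circle_norm_def \<epsilon>_def by (auto intro!: powr_mono2)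
    qed
    moreover have "((\<lambda>n. circle_norm \<alpha> (\<lambda>z. cmod (poly (P n) z) - 1)) \<longlongrightarrow> 0) F"
      using flat False by (simp add: flat_along_def)
    ultimately have "\<epsilon> \<le> 0" using F by (intro tendsto_lowerbound)
    moreover have "\<epsilon> > 0" using c by (simp add: \<epsilon>_def)
    ultimately show False by simp
  qed
qed

section \<open>Perturbations of Fekete polynomials\<close>

lemma eventually_odd_primes_at_top:
  "eventually P odd_primes_at_top \<longleftrightarrow> (\<exists>N. \<forall>p\<ge>N. prime p \<longrightarrow> odd p \<longrightarrow> P p)"
  by (auto simp: odd_primes_at_top_def eventually_inf_principal eventually_at_top_linorder)

lemma odd_primes_at_top_neq_bot: "odd_primes_at_top \<noteq> bot"
proof
  assume "odd_primes_at_top = bot"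
  hence "eventually (\<lambda>_. False) odd_primes_at_top" by simp
  then obtain N :: nat where N: "\<forall>p\<ge>N. prime p \<longrightarrow> odd p \<longrightarrow> False"
    unfolding eventually_odd_primes_at_top by blast
  obtain p where "prime p" "p > max N 2" using bigger_prime by blast
  thus False using N prime_odd_nat[of p] by auto
qed

lemma circle_norm_2: "circle_norm 2 (poly P) = sqrt (\<integral>z. (cmod (poly P z))\<^sup>2 \<partial>circle_measure)"
  by (simp add: circle_norm_def powr_half_sqrt)

text \<open>The \<open>L\<^sup>2\<close> norms are at least of order \<open>sqrt p\<close>, so a perturbation that stays bounded on the circle leaves
  the normalized polynomial small on the same set.\<close>

lemma not_flat_near_fekete:
  fixes Q :: "nat \<Rightarrow> complex poly"
  assumes \<alpha>: "\<alpha> \<ge> 0"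
    and near: "\<And>p z. prime p \<Longrightarrow> odd p \<Longrightarrow> cmod z = 1 \<Longrightarrow>
                 cmod (poly (Q p) z) \<le> cmod (poly (shifted_fekete 0 p) z) + C"
    and norm: "\<And>p. prime p \<Longrightarrow> odd p \<Longrightarrow> real p - 1 \<le> (\<integral>z. (cmod (poly (Q p) z))\<^sup>2 \<partial>circle_measure)"
  shows "\<not> flat_along \<alpha> odd_primes_at_top (\<lambda>p. L2_normalized (Q p))"
proof (rule not_flat_along_if_often_small[where c = "1 / 2 ^ 17"])
  have poly_normalized: "cmod (poly (L2_normalized (Q p)) z) = cmod (poly (Q p) z) / circle_norm 2 (poly (Q p))" for p z
    by (simp add: L2_normalized_def norm_mult norm_divide circle_norm_2)
  have pos: "circle_norm 2 (poly (Q p)) \<ge> sqrt (real p - 1)" if "prime p" "odd p" for p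
    using norm[OF that] by (simp add: circle_norm_2)
  have nz: "circle_norm 2 (poly (Q p)) > 0" if "prime p" "odd p" for p
  proof -
    have "sqrt (real p - 1) > 0" using prime_gt_1_nat[OF that(1)] by simp
    thus ?thesis using pos[OF that] by linarith
  qed
  show "\<forall>\<^sub>F p in odd_primes_at_top. (\<integral>z. (cmod (poly (L2_normalized (Q p)) z))\<^sup>2 \<partial>circle_measure) = 1"
    unfolding eventually_odd_primes_at_top
  proof (intro exI allI impI)
    fix p :: nat assume p: "prime p" "odd p"
    have "(\<integral>z. (cmod (poly (Q p) z))\<^sup>2 \<partial>circle_measure) > 0"
      using norm[OF p] prime_gt_1_nat[OF p(1)] by linarith
    thus "(\<integral>z. (cmod (poly (L2_normalized (Q p)) z))\<^sup>2 \<partial>circle_measure) = 1"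
      unfolding poly_normalized power_divide by (simp add: circle_norm_2)
  qed
  show "\<forall>\<^sub>F p in odd_primes_at_top.
          1 / 2 ^ 17 \<le> measure circle_measure {z. cmod (poly (L2_normalized (Q p)) z) \<le> 1 / 2}"
    unfolding eventually_odd_primes_at_top
  proof (intro exI allI impI)
    fix p assume large: "max 7 (nat \<lceil>64 * C\<^sup>2\<rceil>) \<le> p" and p: "prime p" "odd p"
    have C: "C \<le> sqrt p / 8"
    proof -
      have "(8 * C)\<^sup>2 \<le> real p" using large by (simp add: power_mult_distrib)
      from real_le_rsqrt[OF this] show ?thesis by simp
    qed
    have p7: "7 \<le> p" using large by simp
    have "sqrt (real p) / 2 = sqrt (real p / 4)" by (simp add: real_sqrt_divide)
    also have "\<dots> \<le> sqrt (real p - 1)" using p7 by simp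
    finally have half: "sqrt p / 2 \<le> circle_norm 2 (poly (Q p))" using pos[OF p] by linarith
    let ?A = "{z. cmod (poly (L2_normalized (Q p)) z) \<le> 1 / 2}"
    have A: "?A \<in> sets borel" by (intro borel_closed closed_Collect_le continuous_intros)
    have "{x\<in>{0..1}. cmod (poly (shifted_fekete 0 p) (cis (2 * pi * x))) \<le> sqrt p / 8}
        \<subseteq> {x\<in>{0..1}. cis (2 * pi * x) \<in> ?A}"
    proof safe
      fix x :: real assume x: "cmod (poly (shifted_fekete 0 p) (cis (2 * pi * x))) \<le> sqrt p / 8"
      have "cmod (poly (Q p) (cis (2 * pi * x))) \<le> sqrt p / 8 + sqrt p / 8"
        using near[OF p, of "cis (2 * pi * x)"] x C by simp
      also have "\<dots> \<le> circle_norm 2 (poly (Q p)) / 2" using half by simp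
      finally show "cmod (poly (L2_normalized (Q p)) (cis (2 * pi * x))) \<le> 1 / 2"
        using nz[OF p] by (simp add: poly_normalized field_simps)
    qed
    moreover have "{x\<in>{0..1}. cmod (poly (shifted_fekete 0 p) (cis (2 * pi * x))) \<le> sqrt p / 8} \<in> sets lborel"
    proof -
      have "closed {x\<in>{0..1}. cmod (poly (shifted_fekete 0 p) (cis (2 * pi * x))) \<le> sqrt p / 8}"
        by (intro closed_Collect_conj closed_Collect_le continuous_intros) (simp add: Collect_atLeastAtMost)
      thus ?thesis by (simp add: borel_closed)
    qed
    moreover have "{x\<in>{0..1}. cis (2 * pi * x) \<in> ?A} \<in> fmeasurable lborel"
    proof (rule fmeasurableI2[OF fmeasurable_cbox[of 0 1]])
      have "closed {x\<in>{0..1}. cis (2 * pi * x) \<in> ?A}"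
        unfolding mem_Collect_eq
        by (intro closed_Collect_conj closed_Collect_le continuous_intros) (simp add: Collect_atLeastAtMost)
      thus "{x\<in>{0..1}. cis (2 * pi * x) \<in> ?A} \<in> sets lborel" by (simp add: borel_closed)
    qed auto
    ultimately have "measure lborel {x\<in>{0..1}. cmod (poly (shifted_fekete 0 p) (cis (2 * pi * x))) \<le> sqrt p / 8}
        \<le> measure circle_measure ?A"
      unfolding measure_circle_measure[OF A] by (rule measure_mono_fmeasurable)
    thus "1 / 2 ^ 17 \<le> measure circle_measure ?A"
      using fekete_small_on_large_set[OF p(1) p7] by linarith
  qed
qed (use \<alpha> odd_primes_at_top_neq_bot in auto)

section \<open>Modified and shifted Fekete polynomials\<close>

lemma poly_shifted_fekete:
  "poly (shifted_fekete t p) z = (\<Sum>k = 0..p - 1. of_int (Legendre (int k + t) (int p)) * z ^ k)"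
  by (simp add: shifted_fekete_def poly_sum poly_monom)

text \<open>Shifting the coefficient sequence by one exchanges the constant term for a term of degree \<open>p\<close> with the
  same coefficient, by periodicity of the Legendre symbol.\<close>

lemma shifted_fekete_step:
  assumes "p > 0"
  shows "z * poly (shifted_fekete (t + 1) p) z
       = poly (shifted_fekete t p) z + of_int (Legendre t (int p)) * (z ^ p - 1)"
proof -
  obtain n where n: "p = Suc n" using assms by (cases p) auto
  let ?a = "\<lambda>k. of_int (Legendre (int k + t) (int p)) * z ^ k"
  have "z * poly (shifted_fekete (t + 1) p) z = (\<Sum>k = 0..n. ?a (Suc k))"
    by (simp add: poly_shifted_fekete n sum_distrib_left mult_ac add_ac)
  also have "\<dots> = (\<Sum>k = 0..Suc n. ?a k) - ?a 0"
    unfolding sum.atLeast0_atMost_Suc_shift by (simp add: o_def)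
  also have "\<dots> = poly (shifted_fekete t p) z + ?a p - ?a 0"
    by (simp add: poly_shifted_fekete n)
  also have "Legendre (int p + t) (int p) = Legendre t (int p)"
    by (rule Legendre_cong) (simp add: cong_def)
  finally show ?thesis by (simp add: algebra_simps)
qed

lemma shifted_fekete_near:
  assumes p: "p > 0" and z: "cmod z = 1"
  shows "\<bar>cmod (poly (shifted_fekete t p) z) - cmod (poly (shifted_fekete 0 p) z)\<bar> \<le> 2 * of_int \<bar>t\<bar>"
proof -
  let ?f = "\<lambda>t. cmod (poly (shifted_fekete t p) z)"
  have step: "\<bar>?f (t + 1) - ?f t\<bar> \<le> 2" for t
  proof -
    have "?f (t + 1) = cmod (z * poly (shifted_fekete (t + 1) p) z)" using z by (simp add: norm_mult)
    hence "\<bar>?f (t + 1) - ?f t\<bar> \<le> cmod (of_int (Legendre t (int p)) * (z ^ p - 1))"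
      unfolding shifted_fekete_step[OF p] by (smt (verit) norm_triangle_ineq norm_triangle_ineq2 norm_minus_commute add_diff_cancel_left')
    also have "\<dots> \<le> 1 * 2"
      unfolding norm_mult
    proof (rule mult_mono)
      show "cmod (of_int (Legendre t (int p))) \<le> 1" using Legendre_cases[of t p] by auto
      show "cmod (z ^ p - 1) \<le> 2" using norm_triangle_ineq4[of "z ^ p" 1] z by (simp add: norm_power)
    qed auto
    finally show ?thesis by simp
  qed
  show ?thesis
  proof (induction t rule: int_induct[where k = 0])
    case (step1 i)
    thus ?case using step[of i] by (auto simp: abs_if split: if_splits)
  next
    case (step2 i)
    thus ?case using step[of "i - 1"] by (auto simp: abs_if split: if_splits)
  qed simp
qed

lemma norm_Legendre_nonzero: "\<not> int p dvd a \<Longrightarrow> (cmod (of_int (Legendre a (int p))))\<^sup>2 = 1"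
  using Legendre_cases[of a p] by (auto simp: Legendre_def cong_0_iff)

text \<open>By Parseval, as at most one of \<open>p\<close> consecutive integers is divisible by \<open>p\<close>.\<close>

lemma norm_shifted_fekete:
  assumes p: "p > 0"
  shows "real p - 1 \<le> (\<integral>z. (cmod (poly (shifted_fekete t p) z))\<^sup>2 \<partial>circle_measure)"
proof -
  let ?A = "{k \<in> {0..p - 1}. \<not> int p dvd int k + t}"
  have "card ({0..p - 1} - ?A) \<le> 1"
  proof -
    have "i = j" if "i \<in> {0..p - 1} - ?A" "j \<in> {0..p - 1} - ?A" for i j
    proof -
      have "int p dvd (int i + t) - (int j + t)" using that by (intro dvd_diff) auto
      hence "[int i = int j] (mod int p)" by (simp add: cong_iff_dvd_diff)
      thus "i = j" using that p by (auto simp: cong_int_iff cong_def)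
    qed
    thus ?thesis by (auto simp: card_le_Suc0_iff_eq)
  qed
  moreover have "card ({0..p - 1} - ?A) = card {0..p - 1} - card ?A"
    by (rule card_Diff_subset) auto
  ultimately have "real p - 1 \<le> real (card ?A)" by simp
  also have "\<dots> = (\<Sum>k\<in>?A. (cmod (of_int (Legendre (int k + t) (int p))))\<^sup>2)"
  proof -
    have "(\<Sum>k\<in>?A. (cmod (of_int (Legendre (int k + t) (int p))))\<^sup>2) = (\<Sum>k\<in>?A. 1)"
      by (intro sum.cong refl norm_Legendre_nonzero) simp
    thus ?thesis by simp
  qed
  also have "\<dots> \<le> (\<Sum>k = 0..p - 1. (cmod (of_int (Legendre (int k + t) (int p))))\<^sup>2)"
    by (rule sum_mono2) auto
  also have "\<dots> = (\<integral>z. (cmod (poly (shifted_fekete t p) z))\<^sup>2 \<partial>circle_measure)"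
    unfolding poly_shifted_fekete by (rule parseval_circle[symmetric])
  finally show ?thesis .
qed

lemma poly_modified_fekete:
  "poly (modified_fekete p) z = poly (shifted_fekete 0 p) z + 1"
proof -
  have "poly (shifted_fekete 0 p) z = (\<Sum>k = 1..p - 1. of_int (Legendre (int k) (int p)) * z ^ k)"
    unfolding poly_shifted_fekete add_0_right
    by (rule sum.mono_neutral_right) (auto simp: Legendre_def not_less_eq_eq)
  thus ?thesis by (simp add: modified_fekete_def poly_sum poly_monom)
qed

lemma norm_modified_fekete:
  assumes p: "p > 0"
  shows "real p - 1 \<le> (\<integral>z. (cmod (poly (modified_fekete p) z))\<^sup>2 \<partial>circle_measure)"
proof -
  define a where "a = (\<lambda>k. if k = 0 then 1 else of_int (Legendre (int k) (int p)) :: complex)"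
  have "poly (modified_fekete p) z = (\<Sum>k = 0..p - 1. a k * z ^ k)" for z
    by (simp add: modified_fekete_def poly_sum poly_monom a_def sum.atLeast_Suc_atMost)
  hence "(\<integral>z. (cmod (poly (modified_fekete p) z))\<^sup>2 \<partial>circle_measure) = (\<Sum>k = 0..p - 1. (cmod (a k))\<^sup>2)"
    using parseval_circle[of a "p - 1"] by simp
  also have "\<dots> = (\<Sum>k = 0..p - 1. 1)"
  proof (rule sum.cong)
    fix k assume k: "k \<in> {0..p - 1}"
    show "(cmod (a k))\<^sup>2 = 1"
    proof (cases "k = 0")
      case False
      hence "\<not> p dvd k" using k p by (auto dest: dvd_imp_le)
      thus ?thesis using False norm_Legendre_nonzero[of p "int k"] by (simp add: a_def)
    qed (simp add: a_def)
  qed simp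
  finally show ?thesis using p by simp
qed

theorem mainTheorem4:
  fixes \<alpha> :: real
  assumes "\<alpha> \<ge> 0"
  shows "\<not> flat_along \<alpha> odd_primes_at_top (\<lambda>p. L2_normalized (modified_fekete p)) \<and>
         (\<forall>t::int. \<not> flat_along \<alpha> odd_primes_at_top (\<lambda>p. L2_normalized (shifted_fekete t p)))"
proof (intro conjI allI)
  show "\<not> flat_along \<alpha> odd_primes_at_top (\<lambda>p. L2_normalized (modified_fekete p))"
  proof (rule not_flat_near_fekete[OF assms, where C = 1])
    fix p :: nat and z :: complex
    show "cmod (poly (modified_fekete p) z) \<le> cmod (poly (shifted_fekete 0 p) z) + 1"
      unfolding poly_modified_fekete using norm_triangle_ineq[of _ "1::complex"] by simp
  qed (use norm_modified_fekete prime_gt_0_nat in blast)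
next
  fix t :: int
  show "\<not> flat_along \<alpha> odd_primes_at_top (\<lambda>p. L2_normalized (shifted_fekete t p))"
  proof (rule not_flat_near_fekete[OF assms, where C = "2 * of_int \<bar>t\<bar>"])
    fix p :: nat and z :: complex
    assume "prime p" "cmod z = 1"
    thus "cmod (poly (shifted_fekete t p) z) \<le> cmod (poly (shifted_fekete 0 p) z) + 2 * of_int \<bar>t\<bar>"
      using shifted_fekete_near[of p z t] prime_gt_0_nat[of p] by linarith
  qed (use norm_shifted_fekete prime_gt_0_nat in blast)
qed

end
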